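(* Let $Q$ be a nonzero commutative unital ring, let $n$ be a positive integer and let $\mathbf w=(w_1,\ldots,w_n)\in\mathbb Z_{\ge1}^n$. Let $R_{\mathbf w}$ be the Rees ring of $\mathbf w$ over $Q$ and $d_{\mathbf w}=\operatorname{lcm}(w_1,\ldots,w_n)$. Let $N$ be the least length among vectors strongly equivalent to $\mathbf w$. Then for every integer $k\ge\max(1,N-1)$, the graded ring $R_{\mathbf w}^{(kd_{\mathbf w})}$ is generated in degree $1$.
   Context: The Rees ring is the subring $R_{\mathbf w}:=Q[\{t^dx_i\mid i\in\{1,\ldots,n\},\ d\in\{0,\ldots,w_i\}\}]$ of the polynomial ring $Q[t,x_1,\ldots,x_n]$, graded by the degree in $t$ (so $x_1,\dots,x_n$ have degree $0$); equivalently it is the nonnegative-degree part of $Q[t^{-1},t^{w_1}x_1,\ldots,t^{w_n}x_n]$. Its degree-zero part is $Q[x_1,\ldots,x_n]$. For a $\mathbb Z_{\ge0}$-graded ring $S$ and an integer $r\ge1$, the $r$th Veronese subring is $S^{(r)}:=\bigoplus_{m\ge0}S_{rm}$, where $S_{rm}$ is the $m$th graded component of $S^{(r)}$. A graded ring $S$ is generated in degree $1$ if $S=S_0\oplus\bigoplus_{m\ge1}S_1^m$, where $S_1^m$ is the additive subgroup generated by $m$-fold products of elements of $S_1$. Consider the following operations on a nonempty vector of positive integers: (1) permuting the entries; (2) adding or removing repeated entries; (3) multiplying all entries by the same positive integer or dividing all entries by a positive common divisor; (4) adding or removing entries equal to the least common multiple of the entries while not changing the least common multiple. Two nonempty vectors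 of positive integers are strongly equivalent if they become equal after applying a suitable choice of any number of the operations (1)–(4). *)

theory Defs
  imports
    HOL.Hull
    "HOL-Library.Multiset"
    "HOL-Library.Poly_Mapping"
    "HOL-Computational_Algebra.Group_Closure"
begin

section \<open>Graded rings inside an ambient commutative ring\<close>

text \<open>
  A nonnegatively graded ring is given by the family \<open>S\<close> of its homogeneous components,
  which are additive subgroups of an ambient commutative ring; the underlying ring
  is the sum of the components.
\<close>

definition finite_families :: "(nat \<Rightarrow> 'a::comm_monoid_add set) \<Rightarrow> (nat \<Rightarrow> 'a) set" where
  "finite_families C = {f. (\<forall>m. f m \<in> C m) \<and> finite {m. f m \<noteq> 0}}"

definition sum_of_components :: "(nat \<Rightarrow> 'a::comm_monoid_add set) \<Rightarrow> 'a set" where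
  "sum_of_components C = Sum_any ` finite_families C"

text \<open>\<open>A\<close> is the internal direct sum of the subgroups \<open>C m\<close>.\<close>

definition internal_direct_sum :: "'a::comm_monoid_add set \<Rightarrow> (nat \<Rightarrow> 'a set) \<Rightarrow> bool" where
  "internal_direct_sum A C \<longleftrightarrow> bij_betw Sum_any (finite_families C) A"

definition veronese :: "nat \<Rightarrow> (nat \<Rightarrow> 'a set) \<Rightarrow> nat \<Rightarrow> 'a set" where
  "veronese r S m = S (r * m)"

definition product_power :: "'a::comm_ring_1 set \<Rightarrow> nat \<Rightarrow> 'a set" where
  "product_power A m = group_closure {\<Prod>i<m. f i | f. \<forall>i<m. f i \<in> A}"

definition generated_in_degree_one :: "(nat \<Rightarrow> 'a::comm_ring_1 set) \<Rightarrow> bool" where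
  "generated_in_degree_one S \<longleftrightarrow>
     internal_direct_sum (sum_of_components S)
       (\<lambda>m. if m = 0 then S 0 else product_power (S 1) m)"

section \<open>Rees rings\<close>

datatype rees_var = T | X nat

text \<open>
  Polynomials over \<open>'q\<close> in \<open>t\<close> and \<open>x\<^sub>0, x\<^sub>1, \<dots>\<close>; only the \<open>x\<^sub>i\<close> with
  \<open>i < length w\<close> occur in the Rees ring of \<open>w\<close> (indices start at 0).
\<close>

type_synonym 'q rees_poly = "(rees_var \<Rightarrow>\<^sub>0 nat) \<Rightarrow>\<^sub>0 'q"

definition const :: "'q::comm_ring_1 \<Rightarrow> 'q rees_poly" where
  "const c = Poly_Mapping.single 0 c"

definition var :: "rees_var \<Rightarrow> 'q::comm_ring_1 rees_poly" where
  "var v = Poly_Mapping.single (Poly_Mapping.single v 1) 1"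

definition is_subring :: "'a::comm_ring_1 set \<Rightarrow> bool" where
  "is_subring A \<longleftrightarrow> 1 \<in> A \<and> (\<forall>a\<in>A. \<forall>b\<in>A. a - b \<in> A \<and> a * b \<in> A)"

definition rees_ring :: "nat list \<Rightarrow> 'q::comm_ring_1 rees_poly set" where
  "rees_ring w = is_subring hull
     (range const \<union> {var T ^ d * var (X i) | d i. i < length w \<and> d \<le> w ! i})"

definition t_homogeneous :: "nat \<Rightarrow> 'q::comm_ring_1 rees_poly \<Rightarrow> bool" where
  "t_homogeneous d p \<longleftrightarrow> (\<forall>e \<in> Poly_Mapping.keys p. Poly_Mapping.lookup e T = d)"

definition rees_component :: "nat list \<Rightarrow> nat \<Rightarrow> 'q::comm_ring_1 rees_poly set" where
  "rees_component w d = {p \<in> rees_ring w. t_homogeneous d p}"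

section \<open>Strong equivalence of vectors\<close>

definition positive_vector :: "nat list \<Rightarrow> bool" where
  "positive_vector v \<longleftrightarrow> v \<noteq> [] \<and> (\<forall>a \<in> set v. a > 0)"

text \<open>
  Entries are added and removed at the head only; with permutations this covers all positions.
  An entry \<open>a\<close> equals the lcm of \<open>a # v\<close>, and removing it does not change the lcm, iff
  \<open>a = Lcm (set v)\<close>. The vector that remains has to be nonempty.
\<close>

inductive vector_step :: "nat list \<Rightarrow> nat list \<Rightarrow> bool" where
  permute: "positive_vector v \<Longrightarrow> mset v = mset v' \<Longrightarrow> vector_step v v'"
| add_repeated: "positive_vector v \<Longrightarrow> a \<in> set v \<Longrightarrow> vector_step v (a # v)"
| remove_repeated: "positive_vector v \<Longrightarrow> a \<in> set v \<Longrightarrow> vector_step (a # v) v"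
| multiply: "positive_vector v \<Longrightarrow> c > 0 \<Longrightarrow> vector_step v (map (\<lambda>a. c * a) v)"
| divide: "positive_vector v \<Longrightarrow> c > 0 \<Longrightarrow> \<forall>a \<in> set v. c dvd a \<Longrightarrow>
    vector_step v (map (\<lambda>a. a div c) v)"
| add_lcm: "positive_vector v \<Longrightarrow> a = Lcm (set v) \<Longrightarrow> vector_step v (a # v)"
| remove_lcm: "positive_vector v \<Longrightarrow> a = Lcm (set v) \<Longrightarrow> vector_step (a # v) v"

definition strongly_equivalent :: "nat list \<Rightarrow> nat list \<Rightarrow> bool" where
  "strongly_equivalent v w \<longleftrightarrow> positive_vector v \<and> positive_vector w \<and>
     (\<exists>u. vector_step\<^sup>*\<^sup>* v u \<and> vector_step\<^sup>*\<^sup>* w u)"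

definition min_equivalent_length :: "nat list \<Rightarrow> nat" where
  "min_equivalent_length w = (LEAST l. \<exists>v. strongly_equivalent v w \<and> length v = l)"

end

theory Submission
  imports Defs
begin

text \<open>
  Let \<open>L\<close> be the lcm of the entries of \<open>w\<close>. The number of distinct entries other than \<open>L\<close> is invariant
  under strong equivalence, so it is at most \<open>N\<close>. The ring \<open>R\<^sub>w\<close> is spanned by the monomials
  \<open>t\<^sup>d x\<^sup>a\<close> with \<open>d \<le> w \<cdot> a\<close>. If \<open>w \<cdot> a \<ge> k L m\<close> with \<open>m \<ge> 2\<close>, bundling the variables of
  equal weight into blocks of weight \<open>L\<close> yields at least \<open>k m - N + 1 \<ge> k\<close> full blocks, so a monomial
  of weight exactly \<open>k L\<close> can be split off; by induction on \<open>m\<close> every monomial of degree \<open>k L m\<close>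
  is a product of \<open>m\<close> monomials of degree \<open>k L\<close>.
\<close>

section \<open>An invariant bounding the length of equivalent vectors\<close>

definition proper_entries :: "nat list \<Rightarrow> nat set" where
  "proper_entries w = set w - {Lcm (set w)}"

lemma Lcm_pos:
  assumes "positive_vector v" shows "Lcm (set v) > (0::nat)"
  using assms Lcm_0_iff[of "set v"] by (auto simp: positive_vector_def intro!: Nat.gr0I)

lemma proper_entries_mult:
  assumes "c > 0"
  shows "proper_entries (map (\<lambda>a. c * a) v) = (\<lambda>a. c * a) ` proper_entries v"
\<comment> \<open>The lcm of the empty set is 1 and does not scale with \<open>c\<close>, so the
  empty vector is treated separately.\<close>
proof (cases "v = []")
  case True
  then show ?thesis by (simp add: proper_entries_def)
next
  case False
  then have "Lcm ((*) c ` set v) = c * Lcm (set v)"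
    using Lcm_mult[of "set v" c] by simp
  moreover have "inj ((*) c)" using assms by (auto simp: inj_def)
  ultimately show ?thesis by (simp add: proper_entries_def image_set_diff)
qed

lemma card_proper_entries_mult:
  assumes "c > 0"
  shows "card (proper_entries (map (\<lambda>a. c * a) v)) = card (proper_entries v)"
  unfolding proper_entries_mult[OF assms]
  by (rule card_image) (use assms in \<open>auto simp: inj_on_def\<close>)

text \<open>Operations (1) and (2) preserve the set of entries, (4) touches only the lcm, which
  \<open>proper_entries\<close> discards, and (3) is an injective scaling that commutes with the
  lcm.\<close>

lemma card_proper_entries_step:
  assumes "vector_step v v'"
  shows "card (proper_entries v) = card (proper_entries v')"
  using assms
proof cases
  case permute
  then have "set v = set v'" by (metis set_mset_mset)
  then show ?thesis by (simp add: proper_entries_def)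
next
  case (divide c)
  \<comment> \<open>Division by \<open>c\<close> is undone by multiplication, so \<open>v\<close> is
    a multiple of \<open>v'\<close> and the scaling lemma applies backwards.\<close>
  then have "map (\<lambda>a. c * a) (map (\<lambda>a. a div c) v) = v"
    by (auto intro!: map_idI simp: o_def)
  then show ?thesis using card_proper_entries_mult[of c v'] divide by metis
next
  case (add_repeated a)
  then show ?thesis by (simp add: proper_entries_def insert_absorb)
next
  case (remove_repeated a)
  then show ?thesis by (simp add: proper_entries_def insert_absorb)
next
  case (multiply c)
  then show ?thesis using card_proper_entries_mult by simp
next
  case (add_lcm a)
  then show ?thesis by (auto simp: proper_entries_def)
next
  case (remove_lcm a)
  then show ?thesis by (auto simp: proper_entries_def)
qed

lemma card_proper_entries_le_min_equivalent_length:
  assumes "positive_vector w"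
  shows "card (proper_entries w) \<le> min_equivalent_length w"
proof -
  have steps: "card (proper_entries v) = card (proper_entries u)" if "vector_step\<^sup>*\<^sup>* v u" for v u
    using that by induction (auto dest: card_proper_entries_step)
  \<comment> \<open>\<open>w\<close> is equivalent to itself, so the minimum is attained by some
    \<open>v\<close>.\<close>
  have "\<exists>v. strongly_equivalent v w \<and> length v = min_equivalent_length w"
    unfolding min_equivalent_length_def
    by (rule LeastI_ex) (use assms in \<open>auto simp: strongly_equivalent_def\<close>)
  then obtain v where v: "strongly_equivalent v w" "length v = min_equivalent_length w"
    by blast
  then have "card (proper_entries w) = card (proper_entries v)"
    unfolding strongly_equivalent_def using steps by metis
  also have "\<dots> \<le> card (set v)"
    by (simp add: proper_entries_def card_mono)
  also have "\<dots> \<le> length v"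
    by (rule card_length)
  finally show ?thesis using v by simp
qed

section \<open>Subfamilies of prescribed weight\<close>

lemma subfamily_with_sum:
  fixes a :: "'i \<Rightarrow> nat"
  assumes "finite I" "s \<le> sum a I"
  obtains b where "\<And>i. b i \<le> a i" "sum b I = s"
proof -
  have "\<exists>b. (\<forall>i. b i \<le> a i) \<and> sum b I = s"
    using assms
  proof (induction I arbitrary: s rule: finite_induct)
    case empty
    then show ?case by (intro exI[of _ "\<lambda>_. 0"]) auto
  next
    case (insert j I)
    \<comment> \<open>Greedy choice: index \<open>j\<close> supplies \<open>min s (a j)\<close>, the
      indices in \<open>I\<close> supply the rest.\<close>
    have "s - min s (a j) \<le> sum a I" using insert by auto
    from insert.IH[OF this] obtain b where b: "\<forall>i. b i \<le> a i" "sum b I = s - min s (a j)"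
      by blast
    have "sum (b(j := min s (a j))) I = sum b I"
      using insert by (intro sum.cong) auto
    then show ?case
      using insert b by (intro exI[of _ "b(j := min s (a j))"]) auto
  qed
  then show ?thesis using that by blast
qed

text \<open>Take \<open>L div v\<close> copies of a value \<open>v\<close> as one block of weight \<open>L\<close>. What is left over of a value
  weighs less than \<open>L\<close>, and nothing is left over of the value \<open>L\<close> itself. So more
  than \<open>2 k - card (V - {L})\<close> full blocks exist unless \<open>V \<subseteq> {L}\<close>, when there are at least \<open>2 k\<close>.\<close>

lemma exact_sum_of_values:
  fixes A :: "nat \<Rightarrow> nat"
  assumes V: "finite V" "\<And>v. v \<in> V \<Longrightarrow> v > 0 \<and> v dvd L" and L: "L > 0"
    and k: "k \<ge> 1" "card (V - {L}) \<le> k + 1"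
    and A: "(\<Sum>v\<in>V. v * A v) \<ge> 2 * (k * L)"
  obtains B where "\<And>v. v \<in> V \<Longrightarrow> B v \<le> A v" "(\<Sum>v\<in>V. v * B v) = k * L"
proof -
  define q where "q v = A v div (L div v)" for v
  define rest where "rest v = v * (A v mod (L div v))" for v
  have split: "v * A v = L * q v + rest v" if "v \<in> V" for v
  proof -
    have "v * A v = v * ((L div v) * q v + A v mod (L div v))"
      by (simp add: q_def)
    also have "\<dots> = (v * (L div v)) * q v + rest v"
      by (simp add: rest_def algebra_simps)
    finally show ?thesis using V(2)[OF that] by simp
  qed
  have rest_less: "rest v < L" if "v \<in> V" for v
  proof -
    have *: "v * (L div v) = L" using V(2)[OF that] by simp
    then have "L div v > 0" using L by (intro Nat.gr0I) auto
    then have "rest v < v * (L div v)"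
      unfolding rest_def using V(2)[OF that] by (intro mult_strict_left_mono) auto
    then show ?thesis using * by simp
  qed
  have rest_L: "rest L = 0" using L by (simp add: rest_def)
  have "(\<Sum>v\<in>V. v * A v) = L * sum q V + sum rest V"
    by (simp add: split sum.distrib sum_distrib_left)
  also have "sum rest V = sum rest (V - {L})"
    using V(1) rest_L by (intro sum.mono_neutral_right) auto
  finally have tot: "2 * (k * L) \<le> L * sum q V + sum rest (V - {L})"
    using A by simp
  have "k \<le> sum q V"
  proof (cases "V - {L} = {}")
    case True
    then have "L * (2 * k) \<le> L * sum q V" using tot by (simp only: sum.empty) (simp add: mult_ac)
    then show ?thesis using L by simp
  next
    case False
    then have "sum rest (V - {L}) < (\<Sum>v\<in>V - {L}. L)"
      using V(1) rest_less by (intro sum_strict_mono) auto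
    then have "L * (2 * k) < L * (sum q V + card (V - {L}))"
      using tot by (simp add: algebra_simps)
    then have "2 * k < sum q V + card (V - {L})" using L by simp
    \<comment> \<open>From \<open>card (V - {L}) \<le> k + 1\<close> follows
      \<open>sum q V > k - 1\<close>; the strict bound on the leftovers gains the one that makes
      \<open>k + 1\<close> admissible.\<close>
    then show ?thesis using k by linarith
  qed
  then obtain Q where Q: "\<And>v. Q v \<le> q v" "sum Q V = k"
    using V(1) subfamily_with_sum by metis
  show ?thesis
  \<comment> \<open>Exactly \<open>k\<close> full blocks are used, a block of value \<open>v\<close>
    being \<open>L div v\<close> copies of \<open>v\<close>.\<close>
  proof (rule that[of "\<lambda>v. Q v * (L div v)"])
    fix v assume "v \<in> V"
    have "Q v * (L div v) \<le> q v * (L div v)" using Q by simp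
    also have "\<dots> \<le> A v" by (simp add: q_def)
    finally show "Q v * (L div v) \<le> A v" .
  next
    have "(\<Sum>v\<in>V. v * (Q v * (L div v))) = (\<Sum>v\<in>V. Q v * L)"
      using V(2) by (intro sum.cong) (auto simp: mult.left_commute)
    then show "(\<Sum>v\<in>V. v * (Q v * (L div v))) = k * L"
      by (simp add: Q flip: sum_distrib_right)
  qed
qed

text \<open>Indices of equal weight \<open>v\<close> are interchangeable, so
  \<open>exact_sum_of_values\<close> applies with \<open>sum a (I v)\<close> copies of
  \<open>v\<close>; the copies it selects are then redistributed among the indices in
  \<open>I v\<close>.\<close>

lemma exact_subweight:
  fixes a :: "nat \<Rightarrow> nat"
  assumes w: "positive_vector w" and k: "k \<ge> 1" "card (proper_entries w) \<le> k + 1"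
    and a: "(\<Sum>i<length w. w ! i * a i) \<ge> 2 * (k * Lcm (set w))"
  obtains b where "\<And>i. i < length w \<Longrightarrow> b i \<le> a i"
    "(\<Sum>i<length w. w ! i * b i) = k * Lcm (set w)"
proof -
  define I where "I v = {i. i < length w \<and> w ! i = v}" for v
  have group: "(\<Sum>i<length w. w ! i * c i) = (\<Sum>v\<in>set w. v * sum c (I v))" for c :: "nat \<Rightarrow> nat"
  proof -
    have "(\<Sum>i<length w. w ! i * c i) =
        (\<Sum>v\<in>set w. \<Sum>i\<in>{i\<in>{..<length w}. w ! i = v}. w ! i * c i)"
      by (rule sum.group[symmetric]) auto
    also have "\<dots> = (\<Sum>v\<in>set w. v * sum c (I v))"
      by (auto simp: I_def sum_distrib_left intro!: sum.cong)
    finally show ?thesis .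
  qed
  obtain B where B: "\<And>v. v \<in> set w \<Longrightarrow> B v \<le> sum a (I v)"
      "(\<Sum>v\<in>set w. v * B v) = k * Lcm (set w)"
  proof (rule exact_sum_of_values[of "set w" "Lcm (set w)" k "\<lambda>v. sum a (I v)"])
    show "2 * (k * Lcm (set w)) \<le> (\<Sum>v\<in>set w. v * sum a (I v))"
      using a by (simp add: group)
  qed (use w k Lcm_pos[OF w] in \<open>auto simp: positive_vector_def proper_entries_def\<close>)
  have "\<forall>v\<in>set w. \<exists>c. (\<forall>i. c i \<le> a i) \<and> sum c (I v) = B v"
  proof
    fix v assume "v \<in> set w"
    have "finite (I v)" by (simp add: I_def)
    then show "\<exists>c. (\<forall>i. c i \<le> a i) \<and> sum c (I v) = B v"
      using subfamily_with_sum B(1)[OF \<open>v \<in> set w\<close>] by metis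
  qed
  then obtain c where c: "\<And>v i. v \<in> set w \<Longrightarrow> c v i \<le> a i"
      "\<And>v. v \<in> set w \<Longrightarrow> sum (c v) (I v) = B v"
    by metis
  \<comment> \<open>Each index \<open>i\<close> lies in exactly one class, \<open>I (w ! i)\<close>,
    so the families \<open>c v\<close> glue to a single one.\<close>
  have "(\<Sum>i\<in>I v. c (w ! i) i) = B v" if "v \<in> set w" for v
    using c(2)[OF that] by (simp add: I_def)
  then have "(\<Sum>i<length w. w ! i * c (w ! i) i) = k * Lcm (set w)"
    using B(2) by (simp add: group)
  then show ?thesis
    using c(1) that[of "\<lambda>i. c (w ! i) i"] by simp
qed

section \<open>Monomials of the Rees ring\<close>

definition rees_exponent :: "nat list \<Rightarrow> (rees_var \<Rightarrow>\<^sub>0 nat) \<Rightarrow> bool" where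
  "rees_exponent w e \<longleftrightarrow> Poly_Mapping.keys e \<subseteq> insert T (X ` {..<length w}) \<and>
     Poly_Mapping.lookup e T \<le> (\<Sum>i<length w. w ! i * Poly_Mapping.lookup e (X i))"

lemma rees_exponent_zero [simp]: "rees_exponent w 0"
  by (simp add: rees_exponent_def)

lemma rees_exponent_add:
  assumes "rees_exponent w e" "rees_exponent w f"
  shows "rees_exponent w (e + f)"
  using assms keys_add[of e f]
  by (auto simp: rees_exponent_def lookup_add sum.distrib distrib_left)

lemma rees_exponent_generator:
  assumes "i < length w" "d \<le> w ! i"
  shows "rees_exponent w (Poly_Mapping.single T d + Poly_Mapping.single (X i) 1)"
proof -
  have "(\<Sum>j<length w. w ! j * Poly_Mapping.lookup (Poly_Mapping.single T d + Poly_Mapping.single (X i) 1) (X j))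
     = (\<Sum>j<length w. if j = i then w ! i else 0)"
    by (intro sum.cong) (auto simp: lookup_add lookup_single)
  then show ?thesis
    using assms keys_add[of "Poly_Mapping.single T d" "Poly_Mapping.single (X i) (1::nat)"]
    by (auto simp: rees_exponent_def lookup_add lookup_single split: if_splits)
qed

lemma is_subring_hull: "is_subring (is_subring hull A)"
  by (rule hull_in) (auto simp: is_subring_def)

lemma is_subringD:
  assumes "is_subring A"
  shows "1 \<in> A" "0 \<in> A" "a \<in> A \<Longrightarrow> b \<in> A \<Longrightarrow> a * b \<in> A" "a \<in> A \<Longrightarrow> b \<in> A \<Longrightarrow> a + b \<in> A"
proof -
  have diff: "a \<in> A \<Longrightarrow> b \<in> A \<Longrightarrow> a - b \<in> A" for a b
    using assms by (simp add: is_subring_def)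
  show 1: "1 \<in> A" and "a \<in> A \<Longrightarrow> b \<in> A \<Longrightarrow> a * b \<in> A"
    using assms by (auto simp: is_subring_def)
  show 0: "0 \<in> A" using diff[OF 1 1] by simp
  show "a \<in> A \<Longrightarrow> b \<in> A \<Longrightarrow> a + b \<in> A"
    using diff[of a "0 - b"] diff[of 0 b] 0 by simp
qed

lemma poly_mapping_eq_sum_single:
  "p = (\<Sum>e\<in>Poly_Mapping.keys p. Poly_Mapping.single e (Poly_Mapping.lookup p e))"
  by (rule poly_mapping_eqI)
    (simp add: lookup_sum lookup_single when_def in_keys_iff sum.delta')

lemma var_power: "var v ^ d = Poly_Mapping.single (Poly_Mapping.single v d) 1"
  by (induction d) (auto simp: var_def mult_single simp flip: single_add)

lemma rees_ring_generator:
  "var T ^ d * var (X i) = Poly_Mapping.single (Poly_Mapping.single T d + Poly_Mapping.single (X i) 1) 1"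
  by (simp add: var_power) (simp add: var_def mult_single)

lemma is_subring_rees_ring: "is_subring (rees_ring w)"
  unfolding rees_ring_def by (rule is_subring_hull)

text \<open>Induction on the degree in the \<open>X i\<close>, splitting off one generator
  \<open>var T ^ d * var (X i)\<close> at a time.\<close>

lemma monomial_in_rees_ring:
  assumes "rees_exponent w e"
  shows "Poly_Mapping.single e c \<in> (rees_ring w :: 'q::comm_ring_1 rees_poly set)"
  using assms
proof (induction "\<Sum>i<length w. Poly_Mapping.lookup e (X i)" arbitrary: e)
  case 0
  then have "\<forall>i<length w. Poly_Mapping.lookup e (X i) = 0" by simp
  \<comment> \<open>Without any \<open>X i\<close> the weight bound also forces the exponent of
    \<open>T\<close> to be 0.\<close>
  then have "Poly_Mapping.lookup e v = 0" for v
  proof (cases "v \<in> Poly_Mapping.keys e")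
    case True
    then show ?thesis
      using 0 \<open>\<forall>i<length w. Poly_Mapping.lookup e (X i) = 0\<close>
      by (auto simp: rees_exponent_def)
  qed (simp add: in_keys_iff)
  then have "e = 0" by (intro poly_mapping_eqI) simp
  then show ?case
    unfolding rees_ring_def const_def by (intro hull_inc) auto
next
  case (Suc s)
  then obtain i where i: "i < length w" "Poly_Mapping.lookup e (X i) > 0"
    by (metis (no_types, lifting) bot_nat_0.not_eq_extremum lessThan_iff nat.distinct(1) sum.neutral)
  \<comment> \<open>As many powers of \<open>T\<close> as the generator allows: either none remain,
    or both sides of the weight bound drop by \<open>w ! i\<close>.\<close>
  define d where "d = min (Poly_Mapping.lookup e T) (w ! i)"
  define g where "g = Poly_Mapping.single T d + Poly_Mapping.single (X i) (1::nat)"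
  define e' where "e' = e - g"
  have g: "Poly_Mapping.lookup g T = d" "\<And>j. Poly_Mapping.lookup g (X j) = (if j = i then 1 else 0)"
    by (auto simp: g_def lookup_add lookup_single)
  have le: "Poly_Mapping.lookup g v \<le> Poly_Mapping.lookup e v" for v
    using i by (cases v) (auto simp: g d_def)
  have e: "e = e' + g"
    using le by (intro poly_mapping_eqI) (simp add: e'_def lookup_add lookup_minus)
  have sum_g: "(\<Sum>j<length w. c j * Poly_Mapping.lookup g (X j)) = c i" for c :: "nat \<Rightarrow> nat"
  proof -
    have "(\<Sum>j<length w. c j * Poly_Mapping.lookup g (X j)) = (\<Sum>j<length w. if j = i then c i else 0)"
      by (intro sum.cong) (auto simp: g)
    then show ?thesis using i by simp
  qed
  have "(\<Sum>j<length w. Poly_Mapping.lookup e (X j)) = (\<Sum>j<length w. Poly_Mapping.lookup e' (X j)) + 1"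
    using sum_g[of "\<lambda>_. 1"] by (simp add: e lookup_add sum.distrib)
  then have s: "s = (\<Sum>j<length w. Poly_Mapping.lookup e' (X j))"
    using Suc(2) by simp
  have "(\<Sum>j<length w. w ! j * Poly_Mapping.lookup e (X j)) =
      (\<Sum>j<length w. w ! j * Poly_Mapping.lookup e' (X j)) + w ! i"
    using sum_g[of "\<lambda>j. w ! j"] by (simp add: e lookup_add sum.distrib distrib_left)
  moreover have "Poly_Mapping.lookup e' T = Poly_Mapping.lookup e T - d"
    by (simp add: e'_def lookup_minus g)
  moreover have "Poly_Mapping.keys e' \<subseteq> Poly_Mapping.keys e"
    by (auto simp: e'_def in_keys_iff lookup_minus)
  ultimately have "rees_exponent w e'"
    using Suc.prems by (auto simp: rees_exponent_def d_def)
  then have "Poly_Mapping.single e' c \<in> (rees_ring w :: 'q rees_poly set)"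
    using Suc.hyps(1)[OF s] by blast
  moreover have "Poly_Mapping.single g 1 \<in> (rees_ring w :: 'q rees_poly set)"
    unfolding rees_ring_def g_def rees_ring_generator[symmetric] using i
    by (intro hull_inc UnI2 CollectI exI[of _ d] exI[of _ i]) (simp add: d_def)
  ultimately have "Poly_Mapping.single e' c * Poly_Mapping.single g 1 \<in> (rees_ring w :: 'q rees_poly set)"
    using is_subringD(3)[OF is_subring_rees_ring] by blast
  then show ?case by (simp add: mult_single e)
qed

text \<open>The right-hand side is a subring containing the generators, hence contains the hull;
  conversely, a polynomial is the sum of its terms, which lie in the ring by
  \<open>monomial_in_rees_ring\<close>.\<close>

lemma rees_ring_eq:
  "rees_ring w = {p :: 'q::comm_ring_1 rees_poly. \<forall>e\<in>Poly_Mapping.keys p. rees_exponent w e}"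
    (is "_ = ?M")
proof
  have "is_subring ?M"
    unfolding is_subring_def
  proof (intro conjI ballI)
    fix a b :: "'q rees_poly" assume "a \<in> ?M" "b \<in> ?M"
    moreover have "Poly_Mapping.keys (a - b) \<subseteq> Poly_Mapping.keys a \<union> Poly_Mapping.keys b"
      by (auto simp: in_keys_iff lookup_minus)
    ultimately show "a - b \<in> ?M" by auto
    show "a * b \<in> ?M"
      using \<open>a \<in> ?M\<close> \<open>b \<in> ?M\<close> keys_mult[of a b] by (fastforce intro: rees_exponent_add)
  qed simp
  then show "rees_ring w \<subseteq> ?M"
    unfolding rees_ring_def
    by (rule hull_minimal[rotated])
      (auto simp: const_def rees_ring_generator rees_exponent_generator split: if_splits
        simp del: One_nat_def)
  show "?M \<subseteq> rees_ring w"
  proof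
    fix p :: "'q rees_poly" assume p: "p \<in> ?M"
    have sum: "sum f K \<in> (rees_ring w :: 'q rees_poly set)"
      if "finite K" "\<And>e. e \<in> K \<Longrightarrow> f e \<in> rees_ring w" for f :: "(rees_var \<Rightarrow>\<^sub>0 nat) \<Rightarrow> _" and K
      using that by induction (auto intro: is_subringD[OF is_subring_rees_ring])
    show "p \<in> rees_ring w"
      by (subst poly_mapping_eq_sum_single, rule sum)
        (use p in \<open>auto intro: monomial_in_rees_ring\<close>)
  qed
qed

section \<open>Graded components and factorization of monomials\<close>

lemma rees_component_eq:
  "rees_component w d = {p :: 'q::comm_ring_1 rees_poly.
     \<forall>e\<in>Poly_Mapping.keys p. rees_exponent w e \<and> Poly_Mapping.lookup e T = d}"
  by (auto simp: rees_component_def rees_ring_eq t_homogeneous_def)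

lemma zero_in_rees_component: "0 \<in> rees_component w d"
  by (simp add: rees_component_eq)

lemma one_in_rees_component: "1 \<in> rees_component w 0"
  by (simp add: rees_component_eq)

lemma rees_component_diff:
  assumes "p \<in> rees_component w d" "q \<in> rees_component w d"
  shows "p - q \<in> (rees_component w d :: 'q::comm_ring_1 rees_poly set)"
proof -
  have "Poly_Mapping.keys (p - q) \<subseteq> Poly_Mapping.keys p \<union> Poly_Mapping.keys q"
    by (auto simp: in_keys_iff lookup_minus)
  then show ?thesis using assms by (auto simp: rees_component_eq)
qed

lemma rees_component_mult:
  assumes "p \<in> rees_component w c" "q \<in> rees_component w d"
  shows "p * q \<in> (rees_component w (c + d) :: 'q::comm_ring_1 rees_poly set)"
  using assms keys_mult[of p q]
  by (fastforce simp: rees_component_eq lookup_add intro: rees_exponent_add)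

lemma rees_component_prod:
  fixes f :: "nat \<Rightarrow> 'q::comm_ring_1 rees_poly"
  assumes "\<forall>i<m. f i \<in> rees_component w d"
  shows "(\<Prod>i<m. f i) \<in> rees_component w (d * m)"
  using assms
proof (induction m)
  case 0
  then show ?case by (simp add: one_in_rees_component)
next
  case (Suc m)
  then show ?case
    using rees_component_mult[of "\<Prod>i<m. f i" w "d * m" "f m" d] by (simp add: add.commute)
qed

text \<open>The weight is at least the degree \<open>r * Suc m \<ge> 2 * r\<close>, so
  \<open>exact_subweight\<close> finds a part of the \<open>X\<close> exponents of weight exactly
  \<open>r\<close>; together with \<open>r\<close> powers of \<open>T\<close> it forms
  \<open>g\<close>.\<close>

lemma rees_exponent_split:
  assumes w: "positive_vector w" and k: "k \<ge> 1" "card (proper_entries w) \<le> k + 1"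
    and r: "r = k * Lcm (set w)" and m: "m \<ge> 1"
    and e: "rees_exponent w e" "Poly_Mapping.lookup e T = r * Suc m"
  obtains e' g where "e = e' + g" "rees_exponent w e'" "Poly_Mapping.lookup e' T = r * m"
    "rees_exponent w g" "Poly_Mapping.lookup g T = r"
proof -
  let ?n = "length w"
  have "2 * r \<le> Suc m * r" using m by (intro mult_le_mono1) simp
  also have "\<dots> \<le> (\<Sum>i<?n. w ! i * Poly_Mapping.lookup e (X i))"
    using e by (simp add: rees_exponent_def mult.commute)
  finally obtain b where b: "\<And>i. i < ?n \<Longrightarrow> b i \<le> Poly_Mapping.lookup e (X i)"
      "(\<Sum>i<?n. w ! i * b i) = r"
    using exact_subweight[OF w k] r by metis
  define g where "g = Poly_Mapping.single T r + (\<Sum>i<?n. Poly_Mapping.single (X i) (b i))"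
  have gT: "Poly_Mapping.lookup g T = r"
    by (simp add: g_def lookup_add lookup_single lookup_sum)
  have gX: "Poly_Mapping.lookup g (X i) = (if i < ?n then b i else 0)" for i
    by (simp add: g_def lookup_add lookup_single lookup_sum when_def)
  have le: "Poly_Mapping.lookup g v \<le> Poly_Mapping.lookup e v" for v
    using b e by (cases v) (auto simp: gT gX)
  define e' where "e' = e - g"
  have split: "e = e' + g"
    using le by (intro poly_mapping_eqI) (simp add: e'_def lookup_add lookup_minus)
  have e'T: "Poly_Mapping.lookup e' T = r * m"
    using e by (simp add: e'_def lookup_minus gT)
  \<comment> \<open>Weight and degree both drop by exactly \<open>r\<close>, so the weight bound
    passes to \<open>e'\<close>; a heavier \<open>g\<close> could break it.\<close>
  have "(\<Sum>i<?n. w ! i * Poly_Mapping.lookup e (X i)) =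
      (\<Sum>i<?n. w ! i * Poly_Mapping.lookup e' (X i)) + r"
    using b(2) by (simp add: split lookup_add gX distrib_left sum.distrib)
  moreover have "Poly_Mapping.keys e' \<subseteq> Poly_Mapping.keys e"
    by (auto simp: e'_def in_keys_iff lookup_minus)
  ultimately have "rees_exponent w e'"
    using e e'T by (auto simp: rees_exponent_def)
  moreover have "Poly_Mapping.keys g \<subseteq> insert T (X ` {..<?n})"
  proof
    fix v assume "v \<in> Poly_Mapping.keys g"
    then show "v \<in> insert T (X ` {..<?n})"
      by (cases v) (auto simp: in_keys_iff gX split: if_splits)
  qed
  then have "rees_exponent w g"
    using b(2) by (simp add: rees_exponent_def gT gX)
  ultimately show ?thesis using that split e'T gT by blast
qed

text \<open>Factors of degree \<open>r\<close> are split off until one is left, which keeps the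
  coefficient \<open>c\<close>. The induction starts at \<open>m = 1\<close> because the empty
  product is 1, whereas degree 0 has other monomials.\<close>

lemma monomial_eq_prod:
  assumes w: "positive_vector w" and k: "k \<ge> 1" "card (proper_entries w) \<le> k + 1"
    and r: "r = k * Lcm (set w)" and m: "m \<ge> 1"
    and e: "rees_exponent w e" "Poly_Mapping.lookup e T = r * m"
  shows "\<exists>f. (\<forall>i<m. f i \<in> rees_component w r) \<and>
    Poly_Mapping.single e (c :: 'q::comm_ring_1) = (\<Prod>i<m. f i)"
  using m e
proof (induction m arbitrary: e rule: dec_induct)
  case base
  then show ?case
    by (intro exI[of _ "\<lambda>_. Poly_Mapping.single e c"]) (auto simp: rees_component_eq split: if_splits)
next
  case (step m)
  obtain e' g where eg: "e = e' + g" "rees_exponent w e'" "Poly_Mapping.lookup e' T = r * m"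
    "rees_exponent w g" "Poly_Mapping.lookup g T = r"
    using rees_exponent_split[OF w k r step.hyps(1) step.prems] by blast
  obtain f where f: "\<forall>i<m. f i \<in> rees_component w r" "Poly_Mapping.single e' c = (\<Prod>i<m. f i)"
    using step.IH[OF eg(2,3)] by blast
  let ?f = "f(m := Poly_Mapping.single g 1)"
  have "Poly_Mapping.single g (1::'q) \<in> rees_component w r"
    using eg by (auto simp: rees_component_eq split: if_splits)
  then have "\<forall>i<Suc m. ?f i \<in> rees_component w r"
    using f(1) by simp
  moreover have "Poly_Mapping.single e c = Poly_Mapping.single e' c * Poly_Mapping.single g 1"
    by (simp add: mult_single eg)
  then have "Poly_Mapping.single e c = (\<Prod>i<Suc m. ?f i)"
    by (simp add: f(2))
  ultimately show ?case by blast
qed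

text \<open>Additivity of the degree gives one inclusion. For the other, each term of a polynomial
  is a single product by \<open>monomial_eq_prod\<close>, and the additive closure supplies the
  sums.\<close>

lemma product_power_rees_component:
  assumes w: "positive_vector w" and k: "k \<ge> 1" "card (proper_entries w) \<le> k + 1"
    and r: "r = k * Lcm (set w)" and m: "m \<ge> 1"
  shows "product_power (rees_component w r) m = (rees_component w (r * m) :: 'q::comm_ring_1 rees_poly set)"
proof (intro equalityI subsetI)
  fix p :: "'q rees_poly" assume "p \<in> product_power (rees_component w r) m"
  then show "p \<in> rees_component w (r * m)"
    unfolding product_power_def
  proof induction
    case (base s)
    then show ?case by (auto intro: rees_component_prod zero_in_rees_component)
  qed (rule rees_component_diff)
next
  let ?G = "product_power (rees_component w r) m :: 'q rees_poly set"
  fix p :: "'q rees_poly" assume p: "p \<in> rees_component w (r * m)"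
  have sum: "sum f K \<in> ?G" if "finite K" "\<And>e. e \<in> K \<Longrightarrow> f e \<in> ?G"
    for f :: "(rees_var \<Rightarrow>\<^sub>0 nat) \<Rightarrow> 'q rees_poly" and K
    using that unfolding product_power_def
    by induction (auto intro: group_closure_add)
  show "p \<in> ?G"
  proof (subst poly_mapping_eq_sum_single, rule sum)
    fix e assume "e \<in> Poly_Mapping.keys p"
    then have e: "rees_exponent w e" "Poly_Mapping.lookup e T = r * m"
      using p by (auto simp: rees_component_eq)
    show "Poly_Mapping.single e (Poly_Mapping.lookup p e) \<in> ?G"
      using monomial_eq_prod[OF w k r m e, of "Poly_Mapping.lookup p e"]
      unfolding product_power_def by (intro group_closure.base) auto
  qed simp
qed

section \<open>Directness of the sum and conclusion\<close>

lemma inj_on_Sum_any_rees_components: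
  assumes "inj d"
  shows "inj_on Sum_any
    (finite_families (\<lambda>m. rees_component w (d m) :: 'q::comm_ring_1 rees_poly set))"
proof (rule inj_onI)
  \<comment> \<open>As \<open>d\<close> is injective, the exponent of \<open>T\<close> identifies
    the summand a term comes from, so the sum determines all coefficients of all summands.\<close>
  have coeff: "Poly_Mapping.lookup (f m) e =
      (if Poly_Mapping.lookup e T = d m then Poly_Mapping.lookup (Sum_any f) e else 0)"
    if f: "f \<in> finite_families (\<lambda>m. rees_component w (d m) :: 'q rees_poly set)" for f m e
  proof -
    have fin: "finite {m. f m \<noteq> 0}"
      using f by (simp add: finite_families_def)
    have hom: "Poly_Mapping.lookup (f j) e = 0" if "Poly_Mapping.lookup e T \<noteq> d j" for j
    proof (rule ccontr)
      assume "Poly_Mapping.lookup (f j) e \<noteq> 0"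
      then have "e \<in> Poly_Mapping.keys (f j)" by (simp add: in_keys_iff)
      then show False using f that by (auto simp: finite_families_def rees_component_eq)
    qed
    \<comment> \<open>Inserting \<open>m\<close> keeps this index in the range of summation even
      when \<open>f m = 0\<close>.\<close>
    have "Poly_Mapping.lookup (Sum_any f) e = (\<Sum>j\<in>insert m {j. f j \<noteq> 0}. Poly_Mapping.lookup (f j) e)"
      using fin by (subst Sum_any.expand_superset[of "insert m {j. f j \<noteq> 0}"]) (auto simp: lookup_sum)
    also have "\<dots> = (\<Sum>j\<in>{m}. Poly_Mapping.lookup (f j) e)" if "Poly_Mapping.lookup e T = d m"
      using fin assms that by (intro sum.mono_neutral_right) (auto simp: inj_eq intro!: hom)
    finally show ?thesis using hom[of m] by auto
  qed
  fix f g :: "nat \<Rightarrow> 'q rees_poly"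
  assume fg: "f \<in> finite_families (\<lambda>m. rees_component w (d m))"
    "g \<in> finite_families (\<lambda>m. rees_component w (d m))" "Sum_any f = Sum_any g"
  show "f = g"
    by (intro ext poly_mapping_eqI) (simp only: coeff[OF fg(1)] coeff[OF fg(2)] fg(3))
qed

theorem theorem1p26:
  fixes w :: "nat list" and n k :: nat
  assumes "n \<ge> 1" and "length w = n" and "\<forall>i<n. w ! i \<ge> 1"
    and "k \<ge> max 1 (min_equivalent_length w - 1)"
  shows "generated_in_degree_one
    (veronese (k * Lcm (set w)) (rees_component w :: nat \<Rightarrow> 'q::comm_ring_1 rees_poly set))"
proof -
  define r where "r = k * Lcm (set w)"
  have w: "positive_vector w"
    using assms(1-3) by (fastforce simp: positive_vector_def in_set_conv_nth)
  \<comment> \<open>With \<open>N = min_equivalent_length w\<close>, the bound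
    \<open>N - 1 \<le> k\<close> gives
    \<open>card (proper_entries w) \<le> N \<le> k + 1\<close>.\<close>
  have k: "k \<ge> 1" "card (proper_entries w) \<le> k + 1"
    using assms(4) card_proper_entries_le_min_equivalent_length[OF w] by auto
  have "r > 0" using k Lcm_pos[OF w] by (simp add: r_def)
  then have "inj (\<lambda>m. r * m)" by (auto simp: inj_def)
  then have "inj_on Sum_any
      (finite_families (\<lambda>m. rees_component w (r * m) :: 'q rees_poly set))"
    by (rule inj_on_Sum_any_rees_components)
  \<comment> \<open>The powers of the degree-one part are the full components, so only injectivity
    is at stake: \<open>Sum_any\<close> is onto \<open>sum_of_components\<close> by
    definition.\<close>
  moreover have "(\<lambda>m. if m = 0 then veronese r (rees_component w) 0
        else product_power (veronese r (rees_component w) 1) m) =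
      (\<lambda>m. rees_component w (r * m) :: 'q rees_poly set)"
    using product_power_rees_component[OF w k r_def, where 'q = 'q] by (auto simp: veronese_def fun_eq_iff)
  moreover have "veronese r (rees_component w) = (\<lambda>m. rees_component w (r * m) :: 'q rees_poly set)"
    by (auto simp: veronese_def)
  ultimately show ?thesis
    unfolding generated_in_degree_one_def internal_direct_sum_def sum_of_components_def
      r_def[symmetric]
    by (simp add: bij_betw_def)
qed

end
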